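(* Let $H$ be a graph containing an odd cycle and let $k\geq 2$. Then $f_k(n,H)\leq n+1$ for all $n\geq 2$.
   Context: All colourings are edge-colourings of the complete graph $K_n$; a colouring is proper if any two edges sharing a vertex receive different colours. Two copies of a graph $H$ in an edge-coloured $K_n$ are colour isomorphic if there is a graph isomorphism between them mapping each edge to an edge of the same colour. A $k$-repeat of $H$ is a collection of $k$ pairwise vertex-disjoint, pairwise colour-isomorphic copies of $H$. For integers $k,n\geq 2$ and a graph $H$, $f_k(n,H)$ is the smallest integer $C$ such that there is a proper edge-colouring of $K_n$ with $C$ colours containing no $k$-repeat of $H$. *)

theory Defs
  imports Main "HOL-Library.Extended_Nat"
begin

record 'v ugraph =
  verts :: "'v set"
  edges :: "'v set set"

definition simple_graph :: "'v ugraph \<Rightarrow> bool" where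
  "simple_graph G \<longleftrightarrow> finite (verts G) \<and> (\<forall>e \<in> edges G. e \<subseteq> verts G \<and> card e = 2)"

definition complete_graph :: "nat \<Rightarrow> nat ugraph" where
  "complete_graph n = \<lparr>verts = {..<n}, edges = {e. e \<subseteq> {..<n} \<and> card e = 2}\<rparr>"

definition subgraph :: "'v ugraph \<Rightarrow> 'v ugraph \<Rightarrow> bool" where
  "subgraph F G \<longleftrightarrow> simple_graph F \<and> verts F \<subseteq> verts G \<and> edges F \<subseteq> edges G"

definition graph_iso :: "('v \<Rightarrow> 'w) \<Rightarrow> 'v ugraph \<Rightarrow> 'w ugraph \<Rightarrow> bool" where
  "graph_iso \<phi> F G \<longleftrightarrow> bij_betw \<phi> (verts F) (verts G) \<and>
     (\<forall>u \<in> verts F. \<forall>v \<in> verts F. {u, v} \<in> edges F \<longleftrightarrow> {\<phi> u, \<phi> v} \<in> edges G)"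

text \<open>Cycles are given by their vertices in cyclic order; the index is taken modulo the length,
  so the edge from the last vertex back to the first one is included.\<close>

definition is_cycle :: "'v ugraph \<Rightarrow> 'v list \<Rightarrow> bool" where
  "is_cycle G vs \<longleftrightarrow> length vs \<ge> 3 \<and> distinct vs \<and> set vs \<subseteq> verts G \<and>
     (\<forall>i < length vs. {vs ! i, vs ! (Suc i mod length vs)} \<in> edges G)"

definition contains_odd_cycle :: "'v ugraph \<Rightarrow> bool" where
  "contains_odd_cycle G \<longleftrightarrow> (\<exists>vs. is_cycle G vs \<and> odd (length vs))"

definition proper_colouring :: "'v ugraph \<Rightarrow> ('v set \<Rightarrow> 'c) \<Rightarrow> bool" where
  "proper_colouring G c \<longleftrightarrow>
     (\<forall>e \<in> edges G. \<forall>e' \<in> edges G. e \<noteq> e' \<and> e \<inter> e' \<noteq> {} \<longrightarrow> c e \<noteq> c e')"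

text \<open>A copy is a subgraph, not necessarily an induced one.\<close>

definition is_copy :: "'h ugraph \<Rightarrow> 'v ugraph \<Rightarrow> 'v ugraph \<Rightarrow> bool" where
  "is_copy H G F \<longleftrightarrow> subgraph F G \<and> (\<exists>\<phi>. graph_iso \<phi> H F)"

definition colour_isomorphic ::
  "('v set \<Rightarrow> 'c) \<Rightarrow> 'v ugraph \<Rightarrow> 'v ugraph \<Rightarrow> bool" where
  "colour_isomorphic c F F' \<longleftrightarrow>
     (\<exists>\<phi>. graph_iso \<phi> F F' \<and> (\<forall>e \<in> edges F. c (\<phi> ` e) = c e))"

definition is_repeat ::
  "nat \<Rightarrow> 'h ugraph \<Rightarrow> 'v ugraph \<Rightarrow> ('v set \<Rightarrow> 'c) \<Rightarrow> 'v ugraph set \<Rightarrow> bool" where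
  "is_repeat k H G c S \<longleftrightarrow> finite S \<and> card S = k \<and> (\<forall>F \<in> S. is_copy H G F) \<and>
     (\<forall>F \<in> S. \<forall>F' \<in> S. F \<noteq> F' \<longrightarrow>
        verts F \<inter> verts F' = {} \<and> colour_isomorphic c F F')"

text \<open>A colouring with \<open>C\<close> colours takes its values in the palette \<open>{..<C}\<close>; not all colours
  need be used, which does not affect the minimum. The minimum is taken in the extended naturals,
  so that it is \<open>\<infinity>\<close> when no such colouring exists (for \<open>k \<ge> 2\<close>, possible only for edgeless \<open>H\<close>,
  since the colouring giving all edges distinct colours has no \<open>k\<close>-repeat
  of a graph with an edge). In particular a finite upper bound asserts that a
  colouring exists.\<close>

definition repeat_number :: "nat \<Rightarrow> nat \<Rightarrow> 'h ugraph \<Rightarrow> enat" where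
  "repeat_number k n H = Inf {enat C | C. \<exists>c :: nat set \<Rightarrow> nat.
     proper_colouring (complete_graph n) c \<and>
     c ` edges (complete_graph n) \<subseteq> {..<C} \<and>
     \<not> (\<exists>S. is_repeat k H (complete_graph n) c S)}"

end

theory Submission imports Defs begin

text \<open>Let \<open>m\<close> be the odd one of \<open>n\<close> and \<open>n + 1\<close>, and give the edge \<open>xy\<close> the colour
  \<open>x + y\<close> modulo \<open>m\<close>. Going around an odd cycle \<open>x\<^sub>1 \<dots> x\<^sub>l\<close>, the alternating sum of the colours
  is \<open>2 x\<^sub>1\<close>, which determines \<open>x\<^sub>1\<close> because 2 is invertible modulo \<open>m\<close>. Hence a colour
  isomorphism fixes every vertex of an odd cycle, and colour-isomorphic copies cannot be
  vertex-disjoint.\<close>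

text \<open>Modulo \<open>m\<close> each step negates \<open>d\<close>, so going once around an odd
  cycle gives \<open>d 0 = - d 0\<close>, and 2 is invertible modulo the odd \<open>m\<close>. It is
  applied to the displacement of the cycle's vertices under a colour isomorphism.\<close>

lemma alternating_cycle_dvd:
  fixes d :: "nat \<Rightarrow> int" and m :: int
  assumes step: "\<And>i. i < L \<Longrightarrow> m dvd d i + d (Suc i mod L)"
    and "odd L" and "odd m"
  shows "m dvd d 0"
proof -
  have alt: "m dvd d i - (- 1) ^ i * d 0" if "i < L" for i
    using that
  proof (induction i)
    case (Suc i)
    then have "m dvd d i + d (Suc i)" and "m dvd d i - (- 1) ^ i * d 0"
      using step[of i] by auto
    then have "m dvd (d i + d (Suc i)) - (d i - (- 1) ^ i * d 0)"
      by (rule dvd_diff)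
    then show ?case by simp
  qed simp
  have "L > 0" using \<open>odd L\<close> by (simp add: odd_pos)
  \<comment> \<open>At the last index the successor wraps to 0, while \<open>L - 1\<close> is even,
    so the sign \<open>(- 1) ^ (L - 1)\<close> is 1.\<close>
  then have "m dvd d (L - 1) + d 0" and "m dvd d (L - 1) - d 0"
    using step[of "L - 1"] alt[of "L - 1"] \<open>odd L\<close> by auto
  then have "m dvd (d (L - 1) + d 0) - (d (L - 1) - d 0)"
    by (rule dvd_diff)
  then have "m dvd 2 * d 0" by simp
  moreover have "coprime m 2" using \<open>odd m\<close> by simp
  ultimately show ?thesis
    by (simp add: coprime_dvd_mult_right_iff)
qed

lemma nat_eq_if_dvd_diff:
  fixes x y m :: nat
  assumes "int m dvd int x - int y" "x < m" "y < m"
  shows "x = y"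
  using assms by (metis mod_eq_dvd_iff mod_less of_nat_eq_iff zmod_int)

lemma is_cycle_graph_iso:
  assumes "graph_iso \<phi> F G" and "is_cycle F vs"
  shows "is_cycle G (map \<phi> vs)"
  unfolding is_cycle_def
proof (intro conjI allI impI)
  have bij: "bij_betw \<phi> (verts F) (verts G)"
    and edge: "\<And>u v. u \<in> verts F \<Longrightarrow> v \<in> verts F \<Longrightarrow>
      {u, v} \<in> edges F \<Longrightarrow> {\<phi> u, \<phi> v} \<in> edges G"
    using assms(1) by (auto simp: graph_iso_def)
  have cyc: "length vs \<ge> 3" "distinct vs" "set vs \<subseteq> verts F"
    "\<And>i. i < length vs \<Longrightarrow> {vs ! i, vs ! (Suc i mod length vs)} \<in> edges F"
    using assms(2) by (auto simp: is_cycle_def)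
  show "3 \<le> length (map \<phi> vs)" using cyc(1) by simp
  show "distinct (map \<phi> vs)"
    using cyc(2,3) bij by (auto simp: distinct_map bij_betw_def intro: inj_on_subset)
  show "set (map \<phi> vs) \<subseteq> verts G"
    using cyc(3) bij by (auto simp: bij_betw_def)
  fix i assume "i < length (map \<phi> vs)"
  then have i: "i < length vs" "Suc i mod length vs < length vs"
    using cyc(1) by (auto intro!: mod_less_divisor)
  then have "vs ! i \<in> verts F" "vs ! (Suc i mod length vs) \<in> verts F"
    using cyc(3) nth_mem by blast+
  then show "{map \<phi> vs ! i, map \<phi> vs ! (Suc i mod length (map \<phi> vs))} \<in> edges G"
    using edge cyc(4) i by simp
qed

definition sum_colouring :: "nat \<Rightarrow> nat set \<Rightarrow> nat" where
  "sum_colouring m e = \<Sum>e mod m"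

text \<open>Since \<open>n \<le> m\<close>, distinct vertices are distinct residues modulo
  \<open>m\<close>, so a colour and one endpoint determine the other endpoint.\<close>

lemma proper_sum_colouring:
  assumes "n \<le> m"
  shows "proper_colouring (complete_graph n) (sum_colouring m)"
  unfolding proper_colouring_def
proof (intro ballI impI)
  fix e e'
  assume e: "e \<in> edges (complete_graph n)" and e': "e' \<in> edges (complete_graph n)"
    and ne: "e \<noteq> e' \<and> e \<inter> e' \<noteq> {}"
  then obtain x where x: "x \<in> e" "x \<in> e'" by auto
  have other: "\<exists>y. f = {x, y} \<and> x \<noteq> y \<and> y < m"
    if "x \<in> f" "f \<in> edges (complete_graph n)" for f
    using that \<open>n \<le> m\<close> by (auto simp: complete_graph_def card_2_iff)
  obtain y z where "e = {x, y}" "x \<noteq> y" "y < m" "e' = {x, z}" "x \<noteq> z" "z < m"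
    using other[OF x(1) e] other[OF x(2) e'] by blast
  moreover have "(x + y) mod m \<noteq> (x + z) mod m"
  proof
    assume "(x + y) mod m = (x + z) mod m"
    then have "int (x + y) mod int m = int (x + z) mod int m"
      by (metis zmod_int)
    then have "int m dvd int y - int z"
      by (simp add: mod_eq_dvd_iff)
    then have "y = z" using \<open>y < m\<close> \<open>z < m\<close> by (rule nat_eq_if_dvd_diff)
    then show False using ne \<open>e = {x, y}\<close> \<open>e' = {x, z}\<close> by simp
  qed
  ultimately show "sum_colouring m e \<noteq> sum_colouring m e'"
    by (simp add: sum_colouring_def)
qed

lemma colour_isomorphic_odd_cycle_not_disjoint:
  assumes "odd m" and "n \<le> m"
    and F: "subgraph F (complete_graph n)" and F': "subgraph F' (complete_graph n)"
    and "is_cycle F vs" and "odd (length vs)"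
    and "colour_isomorphic (sum_colouring m) F F'"
  shows "verts F \<inter> verts F' \<noteq> {}"
proof -
  obtain \<phi> where iso: "graph_iso \<phi> F F'"
    and col: "\<And>e. e \<in> edges F \<Longrightarrow> sum_colouring m (\<phi> ` e) = sum_colouring m e"
    using assms(7) by (auto simp: colour_isomorphic_def)
  have cyc: "set vs \<subseteq> verts F"
    "\<And>i. i < length vs \<Longrightarrow> {vs ! i, vs ! (Suc i mod length vs)} \<in> edges F"
    using assms(5) by (auto simp: is_cycle_def)
  have card_edge: "card e = 2" if "e \<in> edges G" "subgraph G (complete_graph n)"
    for e and G :: "nat ugraph"
    using that by (auto simp: subgraph_def simple_graph_def)
  have cyc': "is_cycle F' (map \<phi> vs)"
    using iso assms(5) by (rule is_cycle_graph_iso)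
  \<comment> \<open>The sum runs over a set, so it would count a repeated vertex only once. Edges of
    \<open>F\<close> and of \<open>F'\<close> have two elements, which rules this out for both an
    edge and its image.\<close>
  have sum_pair: "\<Sum>{x, y} = x + y" if "card {x, y} = 2" for x y :: nat
    using that by (cases "x = y") auto
  \<comment> \<open>Equal colours of an edge and its image say exactly that the displacements of its
    two ends cancel modulo \<open>m\<close>.\<close>
  define d where "d i = int (vs ! i) - int (\<phi> (vs ! i))" for i
  have "int m dvd d i + d (Suc i mod length vs)" if i: "i < length vs" for i
  proof -
    define x y where "x = vs ! i" and "y = vs ! (Suc i mod length vs)"
    have "Suc i mod length vs < length vs"
      using i by (intro mod_less_divisor) linarith
    then have "{\<phi> x, \<phi> y} \<in> edges F'"
      using cyc' i by (auto simp: is_cycle_def x_def y_def)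
    moreover have "{x, y} \<in> edges F"
      using cyc(2)[OF i] by (simp add: x_def y_def)
    ultimately have "(x + y) mod m = (\<phi> x + \<phi> y) mod m"
      using col[of "{x, y}"] card_edge F F' by (simp add: sum_colouring_def sum_pair)
    then have "int (x + y) mod int m = int (\<phi> x + \<phi> y) mod int m"
      by (metis zmod_int)
    then show ?thesis
      by (simp add: mod_eq_dvd_iff d_def x_def y_def algebra_simps)
  qed
  then have "int m dvd d 0"
    using alternating_cycle_dvd[of "length vs" "int m" d] assms(1,6) by simp
  moreover have "vs ! 0 \<in> verts F"
    using cyc(1) assms(6) by (metis nth_mem odd_pos subsetD)
  moreover from this have "\<phi> (vs ! 0) \<in> verts F'"
    using iso by (auto simp: graph_iso_def bij_betw_def)
  moreover have "verts F \<subseteq> {..<m}" "verts F' \<subseteq> {..<m}"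
    using F F' \<open>n \<le> m\<close> by (auto simp: subgraph_def complete_graph_def)
  \<comment> \<open>Both vertices lie below \<open>m\<close>, so their congruence is an equality;
    the fixed vertex then lies in both copies.\<close>
  ultimately have "vs ! 0 = \<phi> (vs ! 0)"
    by (intro nat_eq_if_dvd_diff[of m]) (auto simp: d_def)
  with \<open>vs ! 0 \<in> verts F\<close> \<open>\<phi> (vs ! 0) \<in> verts F'\<close> show ?thesis by auto
qed

text \<open>As \<open>k \<ge> 2\<close>, a repeat has two distinct members, which are disjoint and
  colour isomorphic; the odd cycle of \<open>H\<close> carried over to one of them gives a
  contradiction.\<close>

lemma no_repeat_sum_colouring:
  assumes "odd m" and "n \<le> m" and "contains_odd_cycle H" and "k \<ge> 2"
  shows "\<not> is_repeat k H (complete_graph n) (sum_colouring m) S"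
proof
  assume rep: "is_repeat k H (complete_graph n) (sum_colouring m) S"
  then have "\<not> card S \<le> 1" "finite S"
    using \<open>k \<ge> 2\<close> by (auto simp: is_repeat_def)
  then obtain F F' where FF': "F \<in> S" "F' \<in> S" "F \<noteq> F'"
    by (auto simp: card_le_Suc0_iff_eq)
  with rep have copies: "is_copy H (complete_graph n) F" "subgraph F' (complete_graph n)"
    and pair: "verts F \<inter> verts F' = {}" "colour_isomorphic (sum_colouring m) F F'"
    by (auto simp: is_repeat_def is_copy_def)
  obtain \<phi> vs where "graph_iso \<phi> H F" "is_cycle H vs" "odd (length vs)"
    using copies(1) assms(3) by (auto simp: is_copy_def contains_odd_cycle_def)
  then have "is_cycle F (map \<phi> vs)" "odd (length (map \<phi> vs))"
    by (auto intro: is_cycle_graph_iso)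
  then show False
    using colour_isomorphic_odd_cycle_not_disjoint[OF assms(1,2)] copies pair
    by (auto simp: is_copy_def)
qed

theorem theorem2p3:
  fixes H :: "'h ugraph" and k :: nat
  assumes "simple_graph H"
    and "contains_odd_cycle H"
    and "k \<ge> 2"
  shows "\<forall>n \<ge> 2. repeat_number k n H \<le> enat (n + 1)"
proof (intro allI impI)
  fix n :: nat
  assume "n \<ge> 2"
  \<comment> \<open>The least odd number that is at least \<open>n\<close>: oddness makes 2
    invertible, and at most \<open>n + 1\<close> residues serve as colours.\<close>
  define m where "m = (if odd n then n else n + 1)"
  have m: "odd m" "n \<le> m" "m \<le> n + 1"
    by (auto simp: m_def)
  have "sum_colouring m ` edges (complete_graph n) \<subseteq> {..<n + 1}"
  proof -
    have "x mod m < n + 1" for x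
      using m by (metis odd_pos mod_less_divisor order_less_le_trans)
    then show ?thesis by (auto simp: sum_colouring_def)
  qed
  then show "repeat_number k n H \<le> enat (n + 1)"
    \<comment> \<open>The colouring puts \<open>enat (n + 1)\<close> itself into the set whose
      infimum is taken.\<close>
    unfolding repeat_number_def
    using proper_sum_colouring[OF m(2)] no_repeat_sum_colouring[OF m(1,2) assms(2,3)]
    by (intro Inf_lower) blast
qed

end
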